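(* There exist a finite connected graph $G=(V,E)$ and an integer $1\le n\le |V|$ for which the following holds. Let $W=(W_k,k\in\mathbb Z)$ be the simple random walk on $G$ under its invariant distribution, let $\overrightarrow{\tau_n}=\inf\{k\ge0:|\{W_0,\dots,W_k\}|=n\}$ and $\overleftarrow{\tau_n}=\max\{k\le0:|\{W_k,\dots,W_0\}|=n\}$. There does not exist any map $F$, from finite paths of $G$ to trees with $n$ vertices, such that the vertex set of $F(W_0,\dots,W_{\overrightarrow{\tau_n}})$ is included in $\{W_0,\dots,W_{\overrightarrow{\tau_n}}\}$ and such that either - $F(W_0,\dots,W_{\overrightarrow{\tau_n}})$ is uniform on $\mathrm{Subtrees}(G,n)$, or - for some vertex $r$, deterministic or random, $F(W_0,\dots,W_{\overrightarrow{\tau_n}})$ is, conditionally on $r$, uniform on $\mathrm{Subtrees}^{\bullet}_r(G,n)$. The same statement holds with the path $(W_{\overleftarrow{\tau_n}},\dots,W_0)$ instead of $(W_0,\dots,W_{\overrightarrow{\tau_n}})$.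
   Context: The simple random walk on $G$: conditionally on $W_i$ (and the past), $W_{i+1}$ is uniform among the neighbours of $W_i$; under its invariant distribution each $W_i$ has law $\rho_u=\deg(u)/\sum_{v\in V}\deg(v)$. $\mathrm{Subtrees}(G,n)$ is the set of subgraphs of $G$ that are trees with exactly $n$ vertices; $\mathrm{Subtrees}^{\bullet}_r(G,n)$ is the subset of those containing the vertex $r$. *)

theory Defs
  imports "HOL-Probability.Probability"
begin

type_synonym 'v graph = "'v set \<times> 'v set set"

abbreviation verts :: "'v graph \<Rightarrow> 'v set" where
  "verts \<equiv> fst"

abbreviation edges :: "'v graph \<Rightarrow> 'v set set" where
  "edges \<equiv> snd"

definition finite_simple_graph :: "'v graph \<Rightarrow> bool" where
  "finite_simple_graph G \<longleftrightarrow>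
     finite (verts G) \<and> (\<forall>e\<in>edges G. \<exists>u\<in>verts G. \<exists>v\<in>verts G. u \<noteq> v \<and> e = {u, v})"

definition connected_graph :: "'v graph \<Rightarrow> bool" where
  "connected_graph G \<longleftrightarrow>
     verts G \<noteq> {} \<and> (\<forall>u\<in>verts G. \<forall>v\<in>verts G. (u, v) \<in> {(x, y). {x, y} \<in> edges G}\<^sup>*)"

definition cycle :: "'v graph \<Rightarrow> 'v list \<Rightarrow> bool" where
  "cycle G c \<longleftrightarrow>
     3 \<le> length c \<and> distinct c \<and> (\<forall>i<length c. {c ! i, c ! (Suc i mod length c)} \<in> edges G)"

definition tree :: "'v graph \<Rightarrow> bool" where
  "tree T \<longleftrightarrow> finite_simple_graph T \<and> connected_graph T \<and> (\<nexists>c. cycle T c)"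

definition subgraph :: "'v graph \<Rightarrow> 'v graph \<Rightarrow> bool" where
  "subgraph H G \<longleftrightarrow> verts H \<subseteq> verts G \<and> edges H \<subseteq> edges G"

definition subtrees :: "'v graph \<Rightarrow> nat \<Rightarrow> 'v graph set" where
  "subtrees G n = {T. tree T \<and> subgraph T G \<and> card (verts T) = n}"

definition rooted_subtrees :: "'v graph \<Rightarrow> nat \<Rightarrow> 'v \<Rightarrow> 'v graph set" where
  "rooted_subtrees G n r = {T \<in> subtrees G n. r \<in> verts T}"

text \<open>Paths may revisit vertices and edges.\<close>

definition is_path :: "'v graph \<Rightarrow> 'v list \<Rightarrow> bool" where
  "is_path G p \<longleftrightarrow>
     p \<noteq> [] \<and> set p \<subseteq> verts G \<and> successively (\<lambda>u v. {u, v} \<in> edges G) p"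

definition neighbours :: "'v graph \<Rightarrow> 'v \<Rightarrow> 'v set" where
  "neighbours G u = {v. {u, v} \<in> edges G}"

definition deg :: "'v graph \<Rightarrow> 'v \<Rightarrow> nat" where
  "deg G u = card (neighbours G u)"

definition rho :: "'v graph \<Rightarrow> 'v \<Rightarrow> real" where
  "rho G u = real (deg G u) / (\<Sum>v\<in>verts G. real (deg G v))"

text \<open>
  In the transition clause, \<open>x 0, \<dots>, x m\<close> are the values at times \<open>i, \<dots>, i - m\<close>: given any finite
  stretch of the past that has positive probability, the next vertex is uniform among the
  neighbours of the current one. No walk exists on the one-vertex graph (all degrees are 0), so
  existence claims about \<open>G\<close> should require at least two vertices.
\<close>

definition stationary_srw ::
  "'v graph \<Rightarrow> 'w measure \<Rightarrow> (int \<Rightarrow> 'w \<Rightarrow> 'v) \<Rightarrow> bool" where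
  "stationary_srw G M W \<longleftrightarrow>
     prob_space M \<and>
     (\<forall>i. W i \<in> measurable M (count_space (verts G))) \<and>
     (\<forall>i. \<forall>u\<in>verts G. \<P>(\<omega> in M. W i \<omega> = u) = rho G u) \<and>
     (\<forall>i m x. \<forall>u\<in>verts G.
        \<P>(\<omega> in M. \<forall>j\<le>m. W (i - int j) \<omega> = x j) > 0 \<longrightarrow>
        \<P>(\<omega> in M. W (i + 1) \<omega> = u \<bar> \<forall>j\<le>m. W (i - int j) \<omega> = x j) =
          indicator (neighbours G (x 0)) u / real (deg G (x 0)))"

text \<open>
  For \<open>1 \<le> n \<le> |V|\<close> both times are almost surely well defined, since the number of distinct
  vertices seen grows by at most one per step; on the remaining null event they are an
  unspecified integer that does not depend on \<open>\<omega>\<close>.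
\<close>

definition forward_time :: "(int \<Rightarrow> 'w \<Rightarrow> 'v) \<Rightarrow> nat \<Rightarrow> 'w \<Rightarrow> int" where
  "forward_time W n \<omega> = (LEAST k. 0 \<le> k \<and> card ((\<lambda>i. W i \<omega>) ` {0..k}) = n)"

definition backward_time :: "(int \<Rightarrow> 'w \<Rightarrow> 'v) \<Rightarrow> nat \<Rightarrow> 'w \<Rightarrow> int" where
  "backward_time W n \<omega> = (GREATEST k. k \<le> 0 \<and> card ((\<lambda>i. W i \<omega>) ` {k..0}) = n)"

definition forward_path :: "(int \<Rightarrow> 'w \<Rightarrow> 'v) \<Rightarrow> nat \<Rightarrow> 'w \<Rightarrow> 'v list" where
  "forward_path W n \<omega> = map (\<lambda>i. W i \<omega>) [0..forward_time W n \<omega>]"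

definition backward_path :: "(int \<Rightarrow> 'w \<Rightarrow> 'v) \<Rightarrow> nat \<Rightarrow> 'w \<Rightarrow> 'v list" where
  "backward_path W n \<omega> = map (\<lambda>i. W i \<omega>) [backward_time W n \<omega>..0]"

definition uniform_on :: "'w measure \<Rightarrow> ('w \<Rightarrow> 'a) \<Rightarrow> 'a set \<Rightarrow> bool" where
  "uniform_on M X S \<longleftrightarrow> distr M (count_space UNIV) X = measure_pmf (pmf_of_set S)"

text \<open>
  The random vertex \<open>r\<close> may depend on the whole walk and on any further randomness carried by \<open>M\<close>;
  a deterministic vertex is the case of a constant \<open>r\<close>. The measure \<open>uniform_measure M A\<close> is
  \<open>M\<close> conditioned on the event \<open>A\<close>.
\<close>

definition uniform_given_root ::
  "'w measure \<Rightarrow> 'v graph \<Rightarrow> nat \<Rightarrow> ('w \<Rightarrow> 'v) \<Rightarrow> ('w \<Rightarrow> 'v graph) \<Rightarrow> bool" where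
  "uniform_given_root M G n r X \<longleftrightarrow>
     (\<forall>v\<in>verts G. \<P>(\<omega> in M. r \<omega> = v) > 0 \<longrightarrow>
        uniform_on (uniform_measure M {\<omega> \<in> space M. r \<omega> = v}) X (rooted_subtrees G n v))"

definition samples_uniform_subtree ::
  "'w measure \<Rightarrow> 'v graph \<Rightarrow> nat \<Rightarrow> ('w \<Rightarrow> 'v list) \<Rightarrow> ('v list \<Rightarrow> 'v graph) \<Rightarrow> bool" where
  "samples_uniform_subtree M G n P F \<longleftrightarrow>
     (\<forall>p. is_path G p \<longrightarrow> tree (F p) \<and> card (verts (F p)) = n) \<and>
     (AE \<omega> in M. verts (F (P \<omega>)) \<subseteq> set (P \<omega>)) \<and>
     (uniform_on M (\<lambda>\<omega>. F (P \<omega>)) (subtrees G n) \<or>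
      (\<exists>r \<in> measurable M (count_space (verts G)).
         uniform_given_root M G n r (\<lambda>\<omega>. F (P \<omega>))))"

end

theory Submission
  imports Defs
begin

text \<open>
  The graph is the complete bipartite graph \<open>K\<^sub>2\<^sub>,\<^sub>8\<close>, seen as two hubs \<open>0\<close> and \<open>1\<close> joined to eight
  leaves, and \<open>n = 3\<close>. The observable that separates the walk from every uniform law is the event
  that the tree contains both hubs.

  A subtree with three vertices is a cherry: it consists either of one hub and two leaves, or of one
  leaf and both hubs. With \<open>m\<close> leaves there are \<open>m choose 2\<close> cherries of the first kind at each hub,
  but only \<open>m\<close> of the second kind. Counting those through a given root shows that a uniform subtree,
  rooted or not, contains both hubs with probability at most \<open>2 / (m + 1)\<close>
  (\<open>joins_hubs_fraction_le\<close>). This bound does not depend on the root, so it survives averaging over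
  a random root, however the root depends on the walk (\<open>prob_le_if_uniform_given_root\<close>).

  The walk, on the other hand, is at a hub at time \<open>0\<close> with probability \<open>1/2\<close>; its next step leads to
  a leaf, and the step after that to the opposite hub with probability \<open>1/2\<close>. So with probability
  \<open>1/4\<close> the first three vertices are distinct and include both hubs (\<open>hub_crossing\<close>). The path
  stops there, and a tree with three vertices contained in three visited vertices uses all of
  them. Hence \<open>F\<close> returns a tree containing both hubs with probability at least \<open>1/4\<close>, which exceeds
  \<open>2 / (m + 1)\<close> as soon as \<open>m \<ge> 8\<close>. By stationarity the times \<open>-2, -1, 0\<close> behave like
  \<open>0, 1, 2\<close>, which settles the backward path in the same way.
\<close>

section \<open>Cherries\<close>

definition cherry :: "'v \<Rightarrow> 'v \<Rightarrow> 'v \<Rightarrow> 'v graph" where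
  "cherry c a b = ({c, a, b}, {{c, a}, {c, b}})"

text \<open>
  A cycle has at least three vertices, hence would pass through all three and make every pair of
  them adjacent, but \<open>a\<close> and \<open>b\<close> are not.
\<close>

lemma tree_cherry:
  assumes "distinct [c, a, b]"
  shows "tree (cherry c a b)"
proof -
  let ?R = "{(x, y). {x, y} \<in> edges (cherry c a b)}"
  have "(u, c) \<in> ?R\<^sup>*" "(c, u) \<in> ?R\<^sup>*" if "u \<in> {c, a, b}" for u
    using that by (auto simp: cherry_def insert_commute)
  then have "connected_graph (cherry c a b)"
    unfolding connected_graph_def by (auto simp: cherry_def intro: rtrancl_trans)
  moreover have "finite_simple_graph (cherry c a b)"
    using assms by (auto simp: finite_simple_graph_def cherry_def)
  moreover have False if "cycle (cherry c a b) p" for p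
  proof -
    have len: "3 \<le> length p" and dist: "distinct p"
      and edge: "\<And>i. i < length p \<Longrightarrow> {p ! i, p ! (Suc i mod length p)} \<in> edges (cherry c a b)"
      using that by (auto simp: cycle_def)
    have sub: "set p \<subseteq> {c, a, b}"
    proof
      fix x assume "x \<in> set p"
      then obtain i where "i < length p" "x = p ! i" by (auto simp: in_set_conv_nth)
      then show "x \<in> {c, a, b}" using edge[of i] by (auto simp: cherry_def doubleton_eq_iff)
    qed
    have "length p \<le> card {c, a, b}"
      using card_mono[OF _ sub] dist by (simp add: distinct_card)
    then have "length p = 3" using len assms by simp
    then obtain x y z where p: "p = [x, y, z]"
      by (auto simp: numeral_3_eq_3 length_Suc_conv)
    have "{x, y} \<in> edges (cherry c a b)" "{y, z} \<in> edges (cherry c a b)" "{z, x} \<in> edges (cherry c a b)"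
      using edge[of 0] edge[of 1] edge[of 2] by (auto simp: p)
    then show False using dist assms by (auto simp: p cherry_def doubleton_eq_iff)
  qed
  ultimately show ?thesis unfolding tree_def by blast
qed

lemma connected_graph_neighbour:
  assumes "connected_graph T" "u \<in> verts T" "v \<in> verts T" "u \<noteq> v"
  obtains x where "{u, x} \<in> edges T"
proof -
  have "(u, v) \<in> {(x, y). {x, y} \<in> edges T}\<^sup>*"
    using assms by (auto simp: connected_graph_def)
  then show thesis using assms(4) that by (cases rule: converse_rtranclE) auto
qed

section \<open>The complete bipartite graph with two hubs\<close>

definition two_hubs :: "nat \<Rightarrow> nat graph" where
  "two_hubs m = ({..<m + 2}, {{h, b} | h b. h < 2 \<and> 2 \<le> b \<and> b < m + 2})"

lemma verts_two_hubs: "verts (two_hubs m) = {..<m + 2}"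
  by (simp add: two_hubs_def)

lemma edge_two_hubs_iff:
  "{u, v} \<in> edges (two_hubs m) \<longleftrightarrow> u < 2 \<and> v \<in> {2..<m + 2} \<or> v < 2 \<and> u \<in> {2..<m + 2}"
  by (auto simp: two_hubs_def doubleton_eq_iff)

lemma finite_simple_graph_two_hubs: "finite_simple_graph (two_hubs m)"
proof -
  have "\<exists>u\<in>{..<m + 2}. \<exists>v\<in>{..<m + 2}. u \<noteq> v \<and> e = {u, v}"
    if "e = {h, b}" "h < 2" "2 \<le> b" "b < m + 2" for e h b
    using that by (intro bexI[of _ h] bexI[of _ b]) auto
  then show ?thesis unfolding finite_simple_graph_def two_hubs_def by auto
qed

lemma connected_graph_two_hubs:
  assumes "0 < m"
  shows "connected_graph (two_hubs m)"
proof -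
  let ?R = "{(x, y). {x, y} \<in> edges (two_hubs m)}"
  have "(u, 2) \<in> ?R\<^sup>* \<and> (2, u) \<in> ?R\<^sup>*" if "u < m + 2" for u
  proof (cases "u < 2")
    case True
    then show ?thesis using assms by (auto simp: edge_two_hubs_iff)
  next
    case False
    then have "(u, 0) \<in> ?R" "(0, 2) \<in> ?R" "(2, 0) \<in> ?R" "(0, u) \<in> ?R"
      using that assms by (auto simp: edge_two_hubs_iff)
    then show ?thesis by (meson converse_rtrancl_into_rtrancl r_into_rtrancl)
  qed
  then show ?thesis
    unfolding connected_graph_def verts_two_hubs by (auto intro: rtrancl_trans)
qed

lemma neighbours_two_hubs:
  "h < 2 \<Longrightarrow> neighbours (two_hubs m) h = {2..<m + 2}"
  "b \<in> {2..<m + 2} \<Longrightarrow> neighbours (two_hubs m) b = {0, 1}"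
  by (auto simp: neighbours_def edge_two_hubs_iff)

lemma deg_two_hubs:
  "h < 2 \<Longrightarrow> deg (two_hubs m) h = m"
  "b \<in> {2..<m + 2} \<Longrightarrow> deg (two_hubs m) b = 2"
  by (auto simp: deg_def neighbours_two_hubs)

lemma rho_hub:
  assumes "0 < m" "h < 2"
  shows "rho (two_hubs m) h = 1 / 4"
proof -
  have "{..<m + 2} = {0, 1} \<union> {2..<m + 2}" by auto
  then have "(\<Sum>v\<in>verts (two_hubs m). real (deg (two_hubs m) v))
      = (\<Sum>v\<in>{0, 1}. real (deg (two_hubs m) v)) + (\<Sum>v\<in>{2..<m + 2}. real (deg (two_hubs m) v))"
    unfolding verts_two_hubs by (subst sum.union_disjoint[symmetric]) auto
  also have "\<dots> = 4 * real m" by (simp add: deg_two_hubs)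
  finally show ?thesis using assms by (simp add: rho_def deg_two_hubs)
qed

section \<open>Few subtrees contain both hubs\<close>

definition joins_hubs :: "nat graph set" where
  "joins_hubs = {T. {0, 1} \<subseteq> verts T}"

text \<open>
  Beside the hubs the tree has one more vertex, a leaf. The two hubs are not adjacent, so
  connectedness forces the tree to join each of them to that leaf.
\<close>

lemma joins_hubs_eq_cherry:
  assumes "T \<in> subtrees (two_hubs m) 3 \<inter> joins_hubs"
  obtains b where "b \<in> {2..<m + 2}" "T = cherry b 0 1"
proof -
  have fsg: "finite_simple_graph T" and con: "connected_graph T"
    and V: "verts T \<subseteq> {..<m + 2}" and E: "edges T \<subseteq> edges (two_hubs m)"
    and card: "card (verts T) = 3" and hubs: "0 \<in> verts T" "1 \<in> verts T"
    using assms by (auto simp: subtrees_def tree_def subgraph_def verts_two_hubs joins_hubs_def)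
  have fin: "finite (verts T)" using fsg by (simp add: finite_simple_graph_def)
  have "card (verts T - {0, 1}) = 1" using card hubs fin by (simp add: card_Diff_subset)
  then obtain b where b: "verts T - {0, 1} = {b}" by (auto simp: card_1_singleton_iff)
  then have VT: "verts T = {b, 0, 1}" using hubs by auto
  have "b \<in> verts T - {0, 1}" unfolding b by simp
  then have bl: "b \<in> {2..<m + 2}" using V by (auto simp: verts_two_hubs)
  have edge: "\<exists>u v. e = {u, v} \<and> u \<in> {b, 0, 1} \<and> v \<in> {b, 0, 1}" if "e \<in> edges T" for e
    using fsg that unfolding finite_simple_graph_def VT by blast
  have only: "e = {b, 0} \<or> e = {b, 1}" if e: "e \<in> edges T" for e
  proof -
    obtain u v where "e = {u, v}" "u \<in> {b, 0, 1}" "v \<in> {b, 0, 1}" using edge[OF e] by blast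
    moreover have "{u, v} \<in> edges (two_hubs m)" using E e \<open>e = {u, v}\<close> by auto
    ultimately show ?thesis using bl by (auto simp: edge_two_hubs_iff)
  qed
  obtain x where "{0, x} \<in> edges T" using connected_graph_neighbour[OF con hubs] by auto
  then have e0: "{b, 0} \<in> edges T" using only bl by (fastforce simp: doubleton_eq_iff)
  obtain y where "{1, y} \<in> edges T" using connected_graph_neighbour[OF con hubs(2,1)] by auto
  then have e1: "{b, 1} \<in> edges T" using only bl by (fastforce simp: doubleton_eq_iff)
  have "edges T = {{b, 0}, {b, 1}}" using only e0 e1 by auto
  then have "T = cherry b 0 1" using VT by (simp add: cherry_def prod_eq_iff)
  then show thesis using that bl by blast
qed

lemma hub_cherry_subtree:
  assumes "h < 2" "a \<in> {2..<m + 2}" "b \<in> {2..<m + 2}" "a \<noteq> b"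
  shows "cherry h a b \<in> subtrees (two_hubs m) 3 - joins_hubs"
  using assms tree_cherry[of h a b]
  by (auto simp: subtrees_def subgraph_def joins_hubs_def verts_two_hubs cherry_def
      edge_two_hubs_iff less_2_cases_iff)

lemma finite_subtrees:
  assumes "finite_simple_graph G"
  shows "finite (subtrees G n)"
proof -
  have "edges G \<subseteq> Pow (verts G)" using assms by (auto simp: finite_simple_graph_def)
  then have "finite (Pow (verts G) \<times> Pow (edges G))"
    using assms by (auto simp: finite_simple_graph_def dest: finite_subset)
  moreover have "subtrees G n \<subseteq> Pow (verts G) \<times> Pow (edges G)"
    by (auto simp: subtrees_def subgraph_def)
  ultimately show ?thesis by (rule finite_subset[rotated])
qed

lemma card_subtrees_joins_hubs_le:
  "card (subtrees (two_hubs m) 3 \<inter> joins_hubs) \<le> m"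
proof -
  have "subtrees (two_hubs m) 3 \<inter> joins_hubs \<subseteq> (\<lambda>b. cherry b 0 1) ` {2..<m + 2}"
  proof
    fix T assume T: "T \<in> subtrees (two_hubs m) 3 \<inter> joins_hubs"
    obtain b where "b \<in> {2..<m + 2}" "T = cherry b 0 1" by (rule joins_hubs_eq_cherry[OF T])
    then show "T \<in> (\<lambda>b. cherry b 0 1) ` {2..<m + 2}" by (rule rev_image_eqI)
  qed
  then have "card (subtrees (two_hubs m) 3 \<inter> joins_hubs) \<le> card {2..<m + 2}"
    by (rule surj_card_le[rotated]) simp
  then show ?thesis by simp
qed

lemma choose_two_le_card_hub_rooted:
  assumes "h < 2"
  shows "m choose 2 \<le> card (rooted_subtrees (two_hubs m) 3 h - joins_hubs)"
proof -
  let ?R = "rooted_subtrees (two_hubs m) 3 h - joins_hubs"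
  have "{S. S \<subseteq> {2..<m + 2} \<and> card S = 2} \<subseteq> (\<lambda>T. verts T - {h}) ` ?R"
  proof
    fix S assume "S \<in> {S. S \<subseteq> {2..<m + 2} \<and> card S = 2}"
    then obtain a b where ab: "S = {a, b}" "a \<noteq> b" "a \<in> {2..<m + 2}" "b \<in> {2..<m + 2}"
      by (auto simp: card_2_iff)
    have "cherry h a b \<in> ?R"
      using hub_cherry_subtree[OF assms ab(3,4,2)] by (simp add: rooted_subtrees_def cherry_def)
    moreover have "S = verts (cherry h a b) - {h}" using assms ab by (auto simp: cherry_def)
    ultimately show "S \<in> (\<lambda>T. verts T - {h}) ` ?R" by (rule rev_image_eqI)
  qed
  moreover have "finite ?R"
    using finite_subtrees[OF finite_simple_graph_two_hubs] by (simp add: rooted_subtrees_def)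
  ultimately have "card {S. S \<subseteq> {2..<m + 2} \<and> card S = 2} \<le> card ?R"
    by (rule surj_card_le[rotated])
  then show ?thesis by (simp add: n_subsets)
qed

lemma le_card_leaf_rooted:
  assumes "b \<in> {2..<m + 2}"
  shows "m - 1 \<le> card (rooted_subtrees (two_hubs m) 3 b - joins_hubs)"
proof -
  let ?R = "rooted_subtrees (two_hubs m) 3 b - joins_hubs"
  have "(\<lambda>a. cherry 0 b a) ` ({2..<m + 2} - {b}) \<subseteq> ?R"
    using hub_cherry_subtree[of 0 b m] assms
    by (auto simp: rooted_subtrees_def cherry_def)
  moreover have "inj_on (\<lambda>a. cherry 0 b a) ({2..<m + 2} - {b})"
    by (auto simp: inj_on_def cherry_def doubleton_eq_iff insert_eq_iff)
  moreover have "finite ?R"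
    using finite_subtrees[OF finite_simple_graph_two_hubs] by (simp add: rooted_subtrees_def)
  ultimately have "card ({2..<m + 2} - {b}) \<le> card ?R" by (metis card_inj_on_le)
  then show ?thesis using assms by simp
qed

lemma card_leaf_rooted_joins_hubs_le:
  assumes "b \<in> {2..<m + 2}"
  shows "card (rooted_subtrees (two_hubs m) 3 b \<inter> joins_hubs) \<le> 1"
proof -
  have "rooted_subtrees (two_hubs m) 3 b \<inter> joins_hubs \<subseteq> {cherry b 0 1}"
  proof
    fix T assume T: "T \<in> rooted_subtrees (two_hubs m) 3 b \<inter> joins_hubs"
    then have "T \<in> subtrees (two_hubs m) 3 \<inter> joins_hubs" by (simp add: rooted_subtrees_def)
    then obtain b' where b': "b' \<in> {2..<m + 2}" "T = cherry b' 0 1"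
      by (rule joins_hubs_eq_cherry)
    have "b \<in> {b', 0, 1}" using T b' by (simp add: rooted_subtrees_def cherry_def)
    then show "T \<in> {cherry b 0 1}" using assms b' by auto
  qed
  then show ?thesis using card_mono[of "{cherry b 0 1}"] by simp
qed

text \<open>
  All cases reduce to \<open>(m - 1) * k \<le> 2 * l\<close>, where \<open>k\<close> of the trees contain both hubs and \<open>l\<close> do not.
  Through a leaf, \<open>k \<le> 1\<close> and \<open>l \<ge> m - 1\<close>. Through a hub, \<open>k \<le> m\<close> and \<open>l \<ge> m choose 2\<close>; these
  estimates also hold without a root, since they bound \<open>k\<close> over all subtrees and \<open>l\<close> already over those
  through one hub.
\<close>

lemma joins_hubs_fraction_le:
  assumes m: "2 \<le> m"
    and R: "R = subtrees (two_hubs m) 3 \<or> (\<exists>v<m + 2. R = rooted_subtrees (two_hubs m) 3 v)"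
  shows "finite R" "R \<noteq> {}" "real (card (R \<inter> joins_hubs)) / real (card R) \<le> 2 / (real m + 1)"
proof -
  have fin: "finite (subtrees (two_hubs m) 3)"
    by (rule finite_subtrees[OF finite_simple_graph_two_hubs])
  have sub: "R \<subseteq> subtrees (two_hubs m) 3" using R by (auto simp: rooted_subtrees_def)
  show finR: "finite R" by (rule finite_subset[OF sub fin])
  have choose: "2 * (m choose 2) = m * (m - 1)" by (cases m) (simp_all add: choose_two)
  have "card (R \<inter> joins_hubs) * (m - 1) \<le> 2 * card (R - joins_hubs) \<and> 1 \<le> card (R - joins_hubs)"
  proof (cases "\<exists>b\<in>{2..<m + 2}. R = rooted_subtrees (two_hubs m) 3 b")
    case True
    then obtain b where b: "b \<in> {2..<m + 2}" "R = rooted_subtrees (two_hubs m) 3 b" by blast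
    have "card (R \<inter> joins_hubs) * (m - 1) \<le> 1 * (m - 1)"
      using card_leaf_rooted_joins_hubs_le[OF b(1)] b(2) by (intro mult_right_mono) auto
    moreover have "m - 1 \<le> card (R - joins_hubs)" using le_card_leaf_rooted[OF b(1)] b(2) by simp
    ultimately show ?thesis using m by linarith
  next
    case False
    then obtain h where h: "h < 2" "rooted_subtrees (two_hubs m) 3 h \<subseteq> R"
    proof (cases "R = subtrees (two_hubs m) 3")
      case True
      then show thesis by (intro that[of 0]) (auto simp: rooted_subtrees_def)
    next
      case other: False
      then obtain v where "v < m + 2" "R = rooted_subtrees (two_hubs m) 3 v" using R by blast
      then show thesis using False by (intro that[of v]) auto
    qed
    have "card (R \<inter> joins_hubs) \<le> m"
      using card_mono[of "subtrees (two_hubs m) 3 \<inter> joins_hubs" "R \<inter> joins_hubs"] sub fin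
        card_subtrees_joins_hubs_le[of m] by (meson Int_mono finite_Int order_refl order_trans)
    then have "card (R \<inter> joins_hubs) * (m - 1) \<le> 2 * (m choose 2)"
      unfolding choose by (rule mult_right_mono) simp
    moreover have "m choose 2 \<le> card (R - joins_hubs)"
      using choose_two_le_card_hub_rooted[OF h(1), of m] card_mono[of "R - joins_hubs"] h(2) finR
      by (meson Diff_mono finite_Diff order_refl order_trans)
    moreover have "1 \<le> m choose 2" using m by (simp add: Suc_leI)
    ultimately show ?thesis by linarith
  qed
  then have le: "card (R \<inter> joins_hubs) * (m - 1) \<le> 2 * card (R - joins_hubs)"
    and pos: "1 \<le> card (R - joins_hubs)" by auto
  have cR: "card R = card (R \<inter> joins_hubs) + card (R - joins_hubs)"
    using finR by (metis card_Int_Diff)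
  show "R \<noteq> {}" using pos by auto
  have "card (R \<inter> joins_hubs) * (m - 1 + 2) \<le> 2 * card R"
    using le unfolding cR by (simp add: algebra_simps)
  then have "card (R \<inter> joins_hubs) * (m + 1) \<le> 2 * card R" using m by simp
  then have "real (card (R \<inter> joins_hubs) * (m + 1)) \<le> real (2 * card R)" by (rule of_nat_mono)
  then show "real (card (R \<inter> joins_hubs)) / real (card R) \<le> 2 / (real m + 1)"
    using pos cR by (simp add: field_simps)
qed

section \<open>Uniform random variables\<close>

text \<open>
  \<open>distr\<close> is defined for every function, and non-measurable sets have measure zero. But if some
  preimage were not measurable, its complement would not be either, and then a set and its
  complement would both be null for a probability measure. So an equation between \<open>distr\<close> and a
  discrete law contains the measurability of \<open>X\<close>.
\<close>

lemma vimage_in_sets_if_distr_pmf: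
  assumes "prob_space M" and eq: "distr M (count_space UNIV) X = measure_pmf p"
  shows "X -` A \<inter> space M \<in> sets M"
proof (rule ccontr)
  assume A: "X -` A \<inter> space M \<notin> sets M"
  have le: "emeasure (measure_pmf p) B \<le> emeasure M (X -` B \<inter> space M)" for B
    unfolding eq[symmetric] distr_def by (subst emeasure_measure_of_conv) auto
  have "space M - (X -` A \<inter> space M) \<notin> sets M"
    using A by (metis Diff_Diff_Int Int_absorb1 Int_lower2 sets.compl_sets)
  moreover have "X -` (- A) \<inter> space M = space M - (X -` A \<inter> space M)" by auto
  ultimately have "emeasure (measure_pmf p) (- A) = 0" "emeasure (measure_pmf p) A = 0"
    using le[of A] le[of "- A"] A by (auto simp: emeasure_notin_sets)
  then have "emeasure (measure_pmf p) (A \<union> - A) = 0"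
    by (subst plus_emeasure[symmetric]) auto
  then show False using measure_pmf.emeasure_space_1[of p] by simp
qed

lemma prob_uniform_on:
  assumes "prob_space M" "uniform_on M X S" "finite S" "S \<noteq> {}"
  shows "measure M (X -` A \<inter> space M) = card (S \<inter> A) / card S"
proof -
  have eq: "distr M (count_space UNIV) X = measure_pmf (pmf_of_set S)"
    using assms by (simp add: uniform_on_def)
  have "X \<in> measurable M (count_space UNIV)"
    using vimage_in_sets_if_distr_pmf[OF assms(1) eq] by (auto simp: measurable_def)
  then have "measure M (X -` A \<inter> space M) = measure (pmf_of_set S) A"
    unfolding eq[symmetric] by (subst measure_distr) auto
  then show ?thesis using assms by (simp add: measure_pmf_of_set)
qed

text \<open>
  The law of total probability over the values of the root: a bound on the uniform probability of
  \<open>A\<close> that is the same for all roots passes to the mixture. An inclusion of \<open>E\<close> in the event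
  \<open>X \<in> A\<close> is enough, because only a lower bound on the latter is known for the walk.
\<close>

lemma prob_le_if_uniform_given_root:
  assumes M: "prob_space M" and r: "r \<in> measurable M (count_space (verts G))"
    and unif: "uniform_given_root M G n r X" and fin: "finite (verts G)"
    and R: "\<And>v. v \<in> verts G \<Longrightarrow> finite (rooted_subtrees G n v)"
           "\<And>v. v \<in> verts G \<Longrightarrow> rooted_subtrees G n v \<noteq> {}"
    and bound: "\<And>v. v \<in> verts G \<Longrightarrow>
          card (rooted_subtrees G n v \<inter> A) / card (rooted_subtrees G n v) \<le> c"
    and E: "E \<in> sets M" "AE \<omega> in M. \<omega> \<in> E \<longrightarrow> X \<omega> \<in> A"
  shows "measure M E \<le> c"
proof -
  interpret prob_space M by fact
  define B where "B v = {\<omega> \<in> space M. r \<omega> = v}" for v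
  have B: "B v \<in> sets M" if "v \<in> verts G" for v
  proof -
    have "B v = r -` {v} \<inter> space M" by (auto simp: B_def)
    then show ?thesis using measurable_sets[OF r, of "{v}"] that by simp
  qed
  have UB: "(\<Union>v\<in>verts G. B v) = space M"
    using measurable_space[OF r] by (auto simp: B_def)
  have disj: "disjoint_family_on B (verts G)"
    by (auto simp: disjoint_family_on_def B_def)
  have step: "prob (E \<inter> B v) \<le> c * prob (B v)" if v: "v \<in> verts G" for v
  proof (cases "prob (B v) > 0")
    case False
    then have "prob (B v) = 0" using measure_nonneg[of M "B v"] by linarith
    moreover have "prob (E \<inter> B v) \<le> prob (B v)" by (rule finite_measure_mono) (auto simp: B v)
    ultimately show ?thesis by simp
  next
    case True
    let ?U = "uniform_measure M (B v)"
    have em: "emeasure M (B v) \<noteq> 0" "emeasure M (B v) \<noteq> \<infinity>"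
      using True by (auto simp: emeasure_eq_measure)
    have U: "prob_space ?U" using em by (rule prob_space_uniform_measure)
    have un: "uniform_on ?U X (rooted_subtrees G n v)"
      using unif v True by (simp add: uniform_given_root_def B_def)
    have "X -` A \<inter> space ?U \<in> sets ?U"
      using vimage_in_sets_if_distr_pmf[OF U] un unfolding uniform_on_def by blast
    then have XA: "X -` A \<inter> space M \<in> sets M" by simp
    have "prob (E \<inter> B v) \<le> prob (B v \<inter> (X -` A \<inter> space M))"
      using E XA B[OF v] sets.sets_into_space[OF E(1)] by (intro finite_measure_mono_AE) auto
    also have "\<dots> = measure ?U (X -` A \<inter> space M) * prob (B v)"
      using True by (subst measure_uniform_measure[OF em XA]) simp
    also have "measure ?U (X -` A \<inter> space M) \<le> c"
      using prob_uniform_on[OF U un R(1)[OF v] R(2)[OF v], of A] bound[OF v] by simp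
    finally show ?thesis by (simp add: mult_right_mono)
  qed
  have "E = (\<Union>v\<in>verts G. E \<inter> B v)" using UB sets.sets_into_space[OF E(1)] by blast
  then have "prob E = prob (\<Union>v\<in>verts G. E \<inter> B v)" by simp
  also have "\<dots> = (\<Sum>v\<in>verts G. prob (E \<inter> B v))"
    using fin E B disj by (intro finite_measure_finite_Union) (auto simp: disjoint_family_on_def)
  also have "\<dots> \<le> (\<Sum>v\<in>verts G. c * prob (B v))" by (intro sum_mono step)
  also have "\<dots> = c * prob (\<Union>v\<in>verts G. B v)"
    using fin B disj by (subst finite_measure_finite_Union) (auto simp: sum_distrib_left)
  also have "\<dots> = c" unfolding UB by (simp add: prob_space)
  finally show ?thesis .
qed

section \<open>Short paths of the walk\<close>

lemma stationary_srw_path_of_length_two: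
  assumes srw: "stationary_srw G M W" and pos: "0 < rho G x" "0 < deg G x"
    and xyz: "x \<in> verts G" "y \<in> verts G" "z \<in> verts G" "y \<in> neighbours G x" "z \<in> neighbours G y"
  shows "\<P>(\<omega> in M. W i \<omega> = x \<and> W (i + 1) \<omega> = y \<and> W (i + 2) \<omega> = z)
    = rho G x / (deg G x * deg G y)"
proof -
  have step: "\<P>(\<omega> in M. W (k + 1) \<omega> = u \<bar> \<forall>j\<le>l. W (k - int j) \<omega> = f j) =
          indicator (neighbours G (f 0)) u / real (deg G (f 0))"
    if "u \<in> verts G" "\<P>(\<omega> in M. \<forall>j\<le>l. W (k - int j) \<omega> = f j) > 0" for k l f u
    using srw that unfolding stationary_srw_def by blast
  have x: "\<P>(\<omega> in M. W i \<omega> = x) = rho G x"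
    using srw xyz unfolding stationary_srw_def by blast
  have "\<P>(\<omega> in M. W (i + 1) \<omega> = y \<bar> W i \<omega> = x) = 1 / deg G x"
    using step[of y 0 i "\<lambda>_. x"] x pos xyz by simp
  then have xy: "\<P>(\<omega> in M. W (i + 1) \<omega> = y \<and> W i \<omega> = x) = rho G x / deg G x"
    using x pos by (simp add: cond_prob_def field_simps)
  \<comment> \<open>In the transition clause the past is indexed backwards from the present.\<close>
  have past: "(\<forall>j\<le>Suc 0. W (i + 1 - int j) \<omega> = (case j of 0 \<Rightarrow> y | Suc _ \<Rightarrow> x)) \<longleftrightarrow>
      W (i + 1) \<omega> = y \<and> W i \<omega> = x" for \<omega>
    by (auto simp: le_Suc_eq)
  have two: "i + 1 + 1 = i + 2" by simp
  have "\<P>(\<omega> in M. W (i + 2) \<omega> = z \<bar> W (i + 1) \<omega> = y \<and> W i \<omega> = x) = 1 / deg G y"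
    using step[of z "Suc 0" "i + 1" "\<lambda>j. case j of 0 \<Rightarrow> y | Suc _ \<Rightarrow> x", unfolded past two] xy pos xyz
    by simp
  then have "\<P>(\<omega> in M. W (i + 2) \<omega> = z \<and> W (i + 1) \<omega> = y \<and> W i \<omega> = x)
      = (1 / deg G y) * \<P>(\<omega> in M. W (i + 1) \<omega> = y \<and> W i \<omega> = x)"
    using xy pos by (subst nonzero_divide_eq_eq[symmetric]) (simp_all add: cond_prob_def)
  moreover have "{\<omega> \<in> space M. W i \<omega> = x \<and> W (i + 1) \<omega> = y \<and> W (i + 2) \<omega> = z}
      = {\<omega> \<in> space M. W (i + 2) \<omega> = z \<and> W (i + 1) \<omega> = y \<and> W i \<omega> = x}" by auto
  ultimately show ?thesis using xy by simp
qed

text \<open>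
  A stretch of fewer than three times cannot show three vertices, so three distinct vertices in a
  row end the path, and the event of interest depends on three consecutive positions only.
\<close>

lemma forward_path_if_distinct:
  assumes "distinct [W 0 \<omega>, W 1 \<omega>, W 2 \<omega>]"
  shows "forward_path W 3 \<omega> = [W 0 \<omega>, W 1 \<omega>, W 2 \<omega>]"
proof -
  have "{0..2::int} = {0, 1, 2}" by auto
  then have "card ((\<lambda>i. W i \<omega>) ` {0..2}) = 3" using assms by simp
  moreover have "2 \<le> k" if "card ((\<lambda>i. W i \<omega>) ` {0..k}) = 3" for k
    using card_image_le[of "{0..k}" "\<lambda>i. W i \<omega>"] that by simp
  ultimately have "forward_time W 3 \<omega> = 2"
    unfolding forward_time_def by (intro Least_equality) auto
  moreover have "[0..2::int] = [0, 1, 2]" by (simp add: upto.simps)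
  ultimately show ?thesis by (simp add: forward_path_def)
qed

lemma backward_path_if_distinct:
  assumes "distinct [W (- 2) \<omega>, W (- 1) \<omega>, W 0 \<omega>]"
  shows "backward_path W 3 \<omega> = [W (- 2) \<omega>, W (- 1) \<omega>, W 0 \<omega>]"
proof -
  have "{- 2..0::int} = {- 2, - 1, 0}" by auto
  then have "card ((\<lambda>i. W i \<omega>) ` {- 2..0}) = 3" using assms by simp
  moreover have "k \<le> - 2" if "card ((\<lambda>i. W i \<omega>) ` {k..0}) = 3" for k
    using card_image_le[of "{k..0}" "\<lambda>i. W i \<omega>"] that by simp
  ultimately have "backward_time W 3 \<omega> = - 2"
    unfolding backward_time_def by (intro Greatest_equality) auto
  moreover have "[- 2..0::int] = [- 2, - 1, 0]" by (simp add: upto.simps)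
  ultimately show ?thesis by (simp add: backward_path_def)
qed

text \<open>
  For \<open>h \<in> {0, 1}\<close> the opposite hub is \<open>1 - h\<close>. The leaf is part of the index, so that the event is a
  disjoint union of single paths, and surely (not only almost surely) consists of paths of the graph.
\<close>

definition hub_crossing :: "nat \<Rightarrow> 'w measure \<Rightarrow> (int \<Rightarrow> 'w \<Rightarrow> nat) \<Rightarrow> int \<Rightarrow> 'w set" where
  "hub_crossing m M W i = (\<Union>(h, b)\<in>{0, 1} \<times> {2..<m + 2}.
     {\<omega> \<in> space M. W i \<omega> = h \<and> W (i + 1) \<omega> = b \<and> W (i + 2) \<omega> = 1 - h})"

text \<open>
  Each of the \<open>2 * m\<close> paths from a hub over a leaf to the opposite hub has probability
  \<open>1/4 * 1/m * 1/2\<close>.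
\<close>

lemma hub_crossing:
  assumes srw: "stationary_srw (two_hubs m) M W" and m: "0 < m"
  shows "hub_crossing m M W i \<in> sets M" "measure M (hub_crossing m M W i) = 1 / 4"
proof -
  interpret prob_space M using srw by (simp add: stationary_srw_def)
  let ?C = "\<lambda>(h, b). {\<omega> \<in> space M. W i \<omega> = h \<and> W (i + 1) \<omega> = b \<and> W (i + 2) \<omega> = 1 - h}"
  let ?I = "{0::nat, 1} \<times> {2..<m + 2}"
  have ev: "{\<omega> \<in> space M. W k \<omega> = u} \<in> sets M" if "u < m + 2" for k u
  proof -
    have "W k \<in> measurable M (count_space {..<m + 2})"
      using srw by (simp add: stationary_srw_def verts_two_hubs)
    from measurable_sets[OF this, of "{u}"] that show ?thesis
      by (simp add: vimage_def Int_def conj_commute)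
  qed
  have C: "?C p \<in> sets M" if "p \<in> ?I" for p
  proof -
    obtain h b where p: "p = (h, b)" by force
    have "?C p = {\<omega> \<in> space M. W i \<omega> = h} \<inter> {\<omega> \<in> space M. W (i + 1) \<omega> = b}
        \<inter> {\<omega> \<in> space M. W (i + 2) \<omega> = 1 - h}" by (auto simp: p)
    then show ?thesis using that by (auto simp: p intro!: sets.Int ev)
  qed
  show "hub_crossing m M W i \<in> sets M"
    unfolding hub_crossing_def by (intro sets.finite_UN C) auto
  have pC: "prob (?C p) = 1 / (8 * m)" if pI: "p \<in> ?I" for p
  proof -
    obtain h b where p: "p = (h, b)" by force
    then have h: "h < 2" and b: "b \<in> {2..<m + 2}" using pI by auto
    have "prob (?C p) = rho (two_hubs m) h / (deg (two_hubs m) h * deg (two_hubs m) b)"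
      unfolding p prod.case using h b m
      by (intro stationary_srw_path_of_length_two[OF srw])
         (auto simp: rho_hub deg_two_hubs neighbours_two_hubs verts_two_hubs)
    then show ?thesis using h b m by (simp add: rho_hub deg_two_hubs)
  qed
  have "prob (hub_crossing m M W i) = (\<Sum>p\<in>?I. prob (?C p))"
    unfolding hub_crossing_def using C
    by (intro finite_measure_finite_Union) (auto simp: disjoint_family_on_def)
  also have "\<dots> = (\<Sum>p\<in>?I. 1 / (8 * m))" by (intro sum.cong pC) auto
  also have "\<dots> = 1 / 4" using m by (simp add: card_cartesian_product)
  finally show "prob (hub_crossing m M W i) = 1 / 4" .
qed

text \<open>
  Both directions of time are instances: \<open>P\<close> is the forward path for \<open>i = 0\<close> and the backward path
  for \<open>i = - 2\<close>.
\<close>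

lemma not_samples_uniform_subtree_two_hubs:
  assumes m: "8 \<le> m" and srw: "stationary_srw (two_hubs m) M W"
    and P: "\<And>\<omega>. distinct [W i \<omega>, W (i + 1) \<omega>, W (i + 2) \<omega>] \<Longrightarrow>
            P \<omega> = [W i \<omega>, W (i + 1) \<omega>, W (i + 2) \<omega>]"
  shows "\<not> samples_uniform_subtree M (two_hubs m) 3 P F"
proof
  assume F: "samples_uniform_subtree M (two_hubs m) 3 P F"
  interpret prob_space M using srw by (simp add: stationary_srw_def)
  let ?E = "hub_crossing m M W i"
  have E: "?E \<in> sets M" "prob ?E = 1 / 4" using hub_crossing[OF srw] m by auto
  have tree: "card (verts (F p)) = 3" if "is_path (two_hubs m) p" for p
    using F that by (simp add: samples_uniform_subtree_def)
  have "AE \<omega> in M. verts (F (P \<omega>)) \<subseteq> set (P \<omega>)"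
    using F by (simp add: samples_uniform_subtree_def)
  then have AE: "AE \<omega> in M. \<omega> \<in> ?E \<longrightarrow> F (P \<omega>) \<in> joins_hubs"
  proof eventually_elim
    case (elim \<omega>)
    show ?case
    proof
      assume "\<omega> \<in> ?E"
      then obtain h b where hb: "h \<in> {0, 1}" "b \<in> {2..<m + 2}"
        and W: "W i \<omega> = h" "W (i + 1) \<omega> = b" "W (i + 2) \<omega> = 1 - h"
        by (auto simp: hub_crossing_def)
      have p: "P \<omega> = [h, b, 1 - h]" using P[of \<omega>] hb unfolding W by auto
      have "is_path (two_hubs m) (P \<omega>)"
        using hb by (auto simp: p is_path_def verts_two_hubs edge_two_hubs_iff)
      then have "card (verts (F (P \<omega>))) = card (set (P \<omega>))"
        using tree hb by (auto simp: p)
      then have V: "verts (F (P \<omega>)) = set (P \<omega>)" using elim by (intro card_subset_eq) auto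
      have "{0, 1} \<subseteq> set [h, b, 1 - h]" using hb(1) by auto
      then show "F (P \<omega>) \<in> joins_hubs" unfolding p[symmetric] V[symmetric] by (simp add: joins_hubs_def)
    qed
  qed
  have m2: "2 \<le> m" using m by simp
  note fraction = joins_hubs_fraction_le[OF m2]
  from F consider
      (unrooted) "uniform_on M (\<lambda>\<omega>. F (P \<omega>)) (subtrees (two_hubs m) 3)"
    | (rooted) r where "r \<in> measurable M (count_space (verts (two_hubs m)))"
        "uniform_given_root M (two_hubs m) 3 r (\<lambda>\<omega>. F (P \<omega>))"
    unfolding samples_uniform_subtree_def by blast
  then have "prob ?E \<le> 2 / (real m + 1)"
  proof cases
    case unrooted
    let ?A = "(\<lambda>\<omega>. F (P \<omega>)) -` joins_hubs \<inter> space M"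
    have "?A \<in> sets M"
      using vimage_in_sets_if_distr_pmf[OF prob_space_axioms] unrooted
      unfolding uniform_on_def by blast
    then have "prob ?E \<le> prob ?A"
      using AE sets.sets_into_space[OF E(1)] by (intro finite_measure_mono_AE) auto
    also have "\<dots> \<le> 2 / (real m + 1)"
      using prob_uniform_on[OF prob_space_axioms unrooted fraction(1,2)] fraction(3) by auto
    finally show ?thesis .
  next
    case rooted
    show ?thesis
    proof (rule prob_le_if_uniform_given_root[OF prob_space_axioms rooted _ _ _ _ E(1) AE])
      show "finite (verts (two_hubs m))" by (simp add: verts_two_hubs)
    qed (use fraction in \<open>auto simp: verts_two_hubs\<close>)
  qed
  also have "\<dots> < 1 / 4" using m by (simp add: field_simps)
  finally show False using E(2) by simp
qed

theorem theorem25: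
  shows "\<exists>(G :: nat graph) n.
    finite_simple_graph G \<and> connected_graph G \<and> 2 \<le> card (verts G) \<and>
    1 \<le> n \<and> n \<le> card (verts G) \<and>
    (\<forall>(M :: 'w measure) W. stationary_srw G M W \<longrightarrow>
       (\<nexists>F. samples_uniform_subtree M G n (forward_path W n) F) \<and>
       (\<nexists>F. samples_uniform_subtree M G n (backward_path W n) F))"
proof (intro exI[of _ "two_hubs 8"] exI[of _ 3] conjI allI impI)
  fix M :: "'w measure" and W
  assume srw: "stationary_srw (two_hubs 8) M W"
  show "\<nexists>F. samples_uniform_subtree M (two_hubs 8) 3 (forward_path W 3) F"
    using not_samples_uniform_subtree_two_hubs[OF _ srw, of 0] forward_path_if_distinct[of W] by simp
  show "\<nexists>F. samples_uniform_subtree M (two_hubs 8) 3 (backward_path W 3) F"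
    using not_samples_uniform_subtree_two_hubs[OF _ srw, of "- 2"] backward_path_if_distinct[of W] by simp
qed (simp_all add: finite_simple_graph_two_hubs connected_graph_two_hubs verts_two_hubs)

end
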